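(* Assume that $f$ has the following structure: there are a lower convex approximation $l_f(y;x)$ of $f$ on $Q$ and functions $L(y)>0$, $\delta(y)\ge0$ ($y\in Q$) with $$l_f(y;x)\le f(x)\le l_f(y;x)+\frac{L(y)}2\|x-y\|^2+\delta(y)\qquad\forall x,y\in Q .$$ (a) Let $\{(z_{k-1},x_k,\hat x_k)\}_{k\ge0}$ be generated by the Classical Gradient Method (CGM) associated with weight parameters $\{\lambda_k\}_{k\ge0}$ and scaling parameters $\{\beta_k\}_{k\ge-1}$. If $\sigma\beta_{k-1}/\lambda_k\ge L(x_k)$ for all $k\ge0$, then $$\forall k\ge0,\quad f(\hat x_k)-f(x^* )\le\frac1{S_k}\sum_{i=0}^k\lambda_if(x_{i+1})-f(x^* )\le\frac{\beta_kl_d(z_k;x^* )+\sum_{i=0}^k\lambda_i\delta(x_i)}{S_k}.$$ (b) Let $\{(z_{k-1},x_k,\hat x_k)\}_{k\ge0}$ be generated by the Fast Gradient Method (FGM) associated with weight parameters $\{\lambda_k\}_{k\ge0}$ and scaling parameters $\{\beta_k\}_{k\ge-1}$. If $\sigma\beta_{k-1}S_k/\lambda_k^2\ge L(x_k)$ for all $k\ge0$, then $$\forall k\ge0,\quad f(\hat x_k)-f(x^* )\le\frac{\beta_kl_d(z_k;x^* )+\sum_{i=0}^kS_i\delta(x_i)}{S_k}.$$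
   Context: $E$ is a finite-dimensional real vector space with norm $\|\cdot\|$, $E^*$ its dual, $\langle s,x\rangle$ the value of $s\in E^*$ at $x\in E$. $Q\subset E$ is a nonempty closed convex (possibly unbounded) set, and $f:E\to\mathbb{R}\cup\{+\infty\}$ is a proper lower semicontinuous convex function with $Q\subset\operatorname{dom} f$. The problem $\min_{x\in Q}f(x)$ is assumed to have an optimal solution $x^*\in Q$. Prox-function: $d:E\to\mathbb{R}\cup\{+\infty\}$ is a fixed proper lower semicontinuous convex function which is continuously differentiable on $Q$ (in particular finite on $Q$) and strongly convex on $Q$ with parameter $\sigma>0$, i.e. $d(\tau x+(1-\tau)y)\le \tau d(x)+(1-\tau)d(y)-\frac12\sigma\tau(1-\tau)\|x-y\|^2$ for all $x,y\in Q$, $\tau\in[0,1]$. Put $x_0:=\operatorname{argmin}_{x\in Q}d(x)$; it is assumed that $d(x_0)=0$. For $y\in Q$, $l_d(y;x):=d(y)+\langle\nabla d(y),x-y\rangle$. A lower convex approximation of $f$ on $Q$ is a family of proper lower semicontinuous convex functions $l_f(y;\cdot):E\to\mathbb{R}\cup\{+\infty\}$, $y\in Q$, with $f(x)\ge l_f(y;x)$ for all $x\in Q$. Weight parameters: $\lambda_k>0$ for $k\ge0$; $S_k:=\sum_{i=0}^k\lambda_i$. Scaling parameters: $\beta_k\ge\beta_{k-1}>0$ for $k\ge 0$. Property 1. Auxiliary functions $\psi_k$ ($k\ge-1$), where $\psi_k$ is determined by $\{\lambda_i\}_{i=0}^k,\{\beta_i\}_{i=-1}^k,\{x_i\}_{i=0}^k,\{z_i\}_{i=0}^{k-1}$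 and has a unique minimizer $z_k:=\operatorname{argmin}_{x\in Q}\psi_k(x)$ on $Q$, satisfy Property 1 (for test points $\{x_k\}_{k\ge0}\subset Q$, whose first element is $x_0=\operatorname{argmin}_{x\in Q}d(x)$) if: (i) $\min_{x\in Q}\psi_{-1}(x)=0$ and $z_{-1}=x_0$; (ii) for every $k\ge-1$ and $x\in Q$, $\psi_{k+1}(x)\ge\min_{z\in Q}\psi_k(z)+\lambda_{k+1}l_f(x_{k+1};x)+\beta_{k+1}d(x)-\beta_k l_d(z_k;x)$; (iii) for every $k\ge0$, $\min_{x\in Q}\psi_k(x)\le\inf_{x\in Q}\{\sum_{i=0}^k\lambda_i l_f(x_i;x)+\beta_k l_d(z_k;x)\}$. Standard construction: $\psi_{-1}:=\beta_{-1}d$ and, for each $k\ge-1$, $\psi_{k+1}$ is given by either the extended Mirror-Descent model $\psi_{k+1}(x):=\min_{z\in Q}\psi_k(z)+\lambda_{k+1}l_f(x_{k+1};x)+\beta_{k+1}d(x)-\beta_kl_d(z_k;x)$ or the Dual-Averaging model $\psi_{k+1}(x):=\psi_k(x)+\lambda_{k+1}l_f(x_{k+1};x)+\beta_{k+1}d(x)-\beta_kd(x)$ (free choice for each $k$). In both methods below, $\{\psi_k\}_{k\ge-1}$ is defined by the standard construction or by any construction satisfying Property 1. CGM: for $k\ge0$, $x_k:=z_{k-1}:=\operatorname{argmin}_{x\in Q}\psi_{k-1}(x)$ and $\hat x_k:=\frac1{S_k}\sum_{i=0}^k\lambda_ix_{i+1}$. FGM: $x_0:=z_{-1}:=\operatorname{argmin}_{x\in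 Q}d(x)$, $\hat x_0:=z_0:=\operatorname{argmin}_{x\in Q}\psi_0(x)$, and for $k\ge0$: $x_{k+1}:=\frac{\sum_{i=0}^k\lambda_iz_i+\lambda_{k+1}z_k}{S_{k+1}}$, $z_{k+1}:=\operatorname{argmin}_{x\in Q}\psi_{k+1}(x)$, $\hat x_{k+1}:=\frac1{S_{k+1}}\sum_{i=0}^{k+1}\lambda_iz_i$. *)

theory Defs
  imports "HOL-Analysis.Analysis"
begin

text \<open>Extended-real-valued functions are modelled as functions into \<^typ>\<open>ereal\<close>. In \<^typ>\<open>ereal\<close> we have
  \<open>0 * \<infinity> = 0\<close>, so the convexity inequality below is harmless at the endpoints \<open>\<tau> = 0, 1\<close>; properness
  excludes the undefined sum \<open>\<infinity> + (-\<infinity>)\<close>.\<close>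

definition proper_fun :: "('a \<Rightarrow> ereal) \<Rightarrow> bool" where
  "proper_fun g \<longleftrightarrow> (\<forall>x. g x \<noteq> -\<infinity>) \<and> (\<exists>x. g x \<noteq> \<infinity>)"

definition lsc_fun :: "('a::topological_space \<Rightarrow> ereal) \<Rightarrow> bool" where
  "lsc_fun g \<longleftrightarrow> (\<forall>x. g x \<le> Liminf (at x) g)"

definition convex_fun :: "('a::real_vector \<Rightarrow> ereal) \<Rightarrow> bool" where
  "convex_fun g \<longleftrightarrow> (\<forall>x y. \<forall>\<tau>\<in>{0..1}.
     g (\<tau> *\<^sub>R x + (1 - \<tau>) *\<^sub>R y) \<le> ereal \<tau> * g x + ereal (1 - \<tau>) * g y)"

definition proper_lsc_convex :: "('a::real_normed_vector \<Rightarrow> ereal) \<Rightarrow> bool" where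
  "proper_lsc_convex g \<longleftrightarrow> proper_fun g \<and> lsc_fun g \<and> convex_fun g"

definition effective_domain :: "('a \<Rightarrow> ereal) \<Rightarrow> 'a set" where
  "effective_domain g = {x. g x < \<infinity>}"

definition strongly_convex_on_set :: "'a::real_normed_vector set \<Rightarrow> real \<Rightarrow> ('a \<Rightarrow> ereal) \<Rightarrow> bool" where
  "strongly_convex_on_set Q \<sigma> g \<longleftrightarrow> (\<forall>x\<in>Q. \<forall>y\<in>Q. \<forall>\<tau>\<in>{0..1}.
     g (\<tau> *\<^sub>R x + (1 - \<tau>) *\<^sub>R y)
       \<le> ereal \<tau> * g x + ereal (1 - \<tau>) * g y - ereal (1 / 2 * \<sigma> * \<tau> * (1 - \<tau>) * (norm (x - y))\<^sup>2))"

text \<open>The dual space is the type \<^typ>\<open>'a \<Rightarrow>\<^sub>L real\<close> of bounded linear functionals, which in finite dimension are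
  all linear functionals. \<open>Q\<close> may have empty interior, so differentiability is taken within \<open>Q\<close>. The
  gradient \<open>\<nabla>d\<close> is then any continuous selection \<open>Dd\<close> of derivatives within \<open>Q\<close>; for \<open>x, y \<in> Q\<close> the value
  of \<open>Dd y\<close> on \<open>x - y\<close> is the directional derivative of \<open>d\<close> at \<open>y\<close> and does not depend on the selection.\<close>

definition continuously_differentiable_on_set ::
    "'a::real_normed_vector set \<Rightarrow> ('a \<Rightarrow> ereal) \<Rightarrow> ('a \<Rightarrow> ('a \<Rightarrow>\<^sub>L real)) \<Rightarrow> bool" where
  "continuously_differentiable_on_set Q d Dd \<longleftrightarrow>
     Q \<subseteq> effective_domain d \<and> continuous_on Q Dd \<and>
     (\<forall>y\<in>Q. ((\<lambda>x. real_of_ereal (d x)) has_derivative blinfun_apply (Dd y)) (at y within Q))"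

definition prox_function ::
    "'a::real_normed_vector set \<Rightarrow> real \<Rightarrow> ('a \<Rightarrow> ereal) \<Rightarrow> ('a \<Rightarrow> ('a \<Rightarrow>\<^sub>L real)) \<Rightarrow> 'a \<Rightarrow> bool" where
  "prox_function Q \<sigma> d Dd x0 \<longleftrightarrow>
     proper_lsc_convex d \<and> continuously_differentiable_on_set Q d Dd \<and>
     \<sigma> > 0 \<and> strongly_convex_on_set Q \<sigma> d \<and>
     is_arg_min d (\<lambda>x. x \<in> Q) x0 \<and> d x0 = 0"

definition l_d :: "('a::real_normed_vector \<Rightarrow> ereal) \<Rightarrow> ('a \<Rightarrow> ('a \<Rightarrow>\<^sub>L real)) \<Rightarrow> 'a \<Rightarrow> 'a \<Rightarrow> real" where
  "l_d d Dd y x = real_of_ereal (d y) + blinfun_apply (Dd y) (x - y)"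

definition lower_convex_approximation ::
    "'a::real_normed_vector set \<Rightarrow> ('a \<Rightarrow> ereal) \<Rightarrow> ('a \<Rightarrow> 'a \<Rightarrow> ereal) \<Rightarrow> bool" where
  "lower_convex_approximation Q f lf \<longleftrightarrow>
     (\<forall>y\<in>Q. proper_lsc_convex (lf y) \<and> (\<forall>x\<in>Q. lf y x \<le> f x))"

text \<open>All sequences are indexed by \<^typ>\<open>int\<close>, so that the index \<open>-1\<close> is available: \<open>\<beta>\<close>, \<open>z\<close>, \<open>\<psi>\<close> are used
  at indices \<open>\<ge> -1\<close>, and \<open>lam\<close>, \<open>x\<close>, \<open>xhat\<close> at indices \<open>\<ge> 0\<close>.\<close>

definition weight_sum :: "(int \<Rightarrow> real) \<Rightarrow> int \<Rightarrow> real" where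
  "weight_sum lam k = (\<Sum>i=0..k. lam i)"

definition method_parameters :: "(int \<Rightarrow> real) \<Rightarrow> (int \<Rightarrow> real) \<Rightarrow> bool" where
  "method_parameters lam \<beta> \<longleftrightarrow> (\<forall>k\<ge>0. lam k > 0 \<and> \<beta> k \<ge> \<beta> (k - 1) \<and> \<beta> (k - 1) > 0)"

definition md_model where
  "md_model Q lf d Dd lam \<beta> x z (\<psi> :: int \<Rightarrow> 'a::real_normed_vector \<Rightarrow> ereal) k w =
     (INF u\<in>Q. \<psi> k u) + ereal (lam (k + 1)) * lf (x (k + 1)) w + ereal (\<beta> (k + 1)) * d w
       - ereal (\<beta> k * l_d d Dd (z k) w)"

definition da_model where
  "da_model lf d lam \<beta> x (\<psi> :: int \<Rightarrow> 'a::real_normed_vector \<Rightarrow> ereal) k w =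
     \<psi> k w + ereal (lam (k + 1)) * lf (x (k + 1)) w + ereal (\<beta> (k + 1)) * d w
       - ereal (\<beta> k) * d w"

text \<open>The equations for \<open>\<psi>\<close> are only required on \<open>Q\<close>: the values of \<open>\<psi>\<close> elsewhere play no role, and the
  right-hand sides may be of the form \<open>\<infinity> - \<infinity>\<close> there.\<close>

definition standard_construction ::
    "'a::real_normed_vector set \<Rightarrow> ('a \<Rightarrow> 'a \<Rightarrow> ereal) \<Rightarrow> ('a \<Rightarrow> ereal) \<Rightarrow> ('a \<Rightarrow> ('a \<Rightarrow>\<^sub>L real)) \<Rightarrow>
     (int \<Rightarrow> real) \<Rightarrow> (int \<Rightarrow> real) \<Rightarrow> (int \<Rightarrow> 'a) \<Rightarrow> (int \<Rightarrow> 'a) \<Rightarrow> (int \<Rightarrow> 'a \<Rightarrow> ereal) \<Rightarrow> bool" where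
  "standard_construction Q lf d Dd lam \<beta> x z \<psi> \<longleftrightarrow>
     (\<forall>w\<in>Q. \<psi> (-1) w = ereal (\<beta> (-1)) * d w) \<and>
     (\<forall>k\<ge>-1. (\<forall>w\<in>Q. \<psi> (k + 1) w = md_model Q lf d Dd lam \<beta> x z \<psi> k w) \<or>
              (\<forall>w\<in>Q. \<psi> (k + 1) w = da_model lf d lam \<beta> x \<psi> k w))"

definition property1 ::
    "'a::real_normed_vector set \<Rightarrow> ('a \<Rightarrow> 'a \<Rightarrow> ereal) \<Rightarrow> ('a \<Rightarrow> ereal) \<Rightarrow> ('a \<Rightarrow> ('a \<Rightarrow>\<^sub>L real)) \<Rightarrow> 'a \<Rightarrow>
     (int \<Rightarrow> real) \<Rightarrow> (int \<Rightarrow> real) \<Rightarrow> (int \<Rightarrow> 'a) \<Rightarrow> (int \<Rightarrow> 'a) \<Rightarrow> (int \<Rightarrow> 'a \<Rightarrow> ereal) \<Rightarrow> bool" where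
  "property1 Q lf d Dd x0 lam \<beta> x z \<psi> \<longleftrightarrow>
     x 0 = x0 \<and> (\<forall>k\<ge>0. x k \<in> Q) \<and>
     (\<forall>k\<ge>-1. \<forall>w. is_arg_min (\<psi> k) (\<lambda>u. u \<in> Q) w \<longleftrightarrow> w = z k) \<and>
     (INF u\<in>Q. \<psi> (-1) u) = 0 \<and> z (-1) = x0 \<and>
     (\<forall>k\<ge>-1. \<forall>w\<in>Q. \<psi> (k + 1) w \<ge> md_model Q lf d Dd lam \<beta> x z \<psi> k w) \<and>
     (\<forall>k\<ge>0. (INF u\<in>Q. \<psi> k u) \<le>
        (INF w\<in>Q. (\<Sum>i=0..k. ereal (lam i) * lf (x i) w) + ereal (\<beta> k * l_d d Dd (z k) w)))"

definition auxiliary_functions where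
  "auxiliary_functions Q lf d Dd x0 lam \<beta> x z \<psi> \<longleftrightarrow>
     standard_construction Q lf d Dd lam \<beta> x z \<psi> \<or> property1 Q lf d Dd x0 lam \<beta> x z \<psi>"

definition classical_gradient_method ::
    "'a::real_normed_vector set \<Rightarrow> ('a \<Rightarrow> 'a \<Rightarrow> ereal) \<Rightarrow> ('a \<Rightarrow> ereal) \<Rightarrow> ('a \<Rightarrow> ('a \<Rightarrow>\<^sub>L real)) \<Rightarrow> 'a \<Rightarrow>
     (int \<Rightarrow> real) \<Rightarrow> (int \<Rightarrow> real) \<Rightarrow> (int \<Rightarrow> 'a \<Rightarrow> ereal) \<Rightarrow>
     (int \<Rightarrow> 'a) \<Rightarrow> (int \<Rightarrow> 'a) \<Rightarrow> (int \<Rightarrow> 'a) \<Rightarrow> bool" where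
  "classical_gradient_method Q lf d Dd x0 lam \<beta> \<psi> z x xhat \<longleftrightarrow>
     auxiliary_functions Q lf d Dd x0 lam \<beta> x z \<psi> \<and>
     (\<forall>k\<ge>0. is_arg_min (\<psi> (k - 1)) (\<lambda>u. u \<in> Q) (z (k - 1)) \<and> x k = z (k - 1) \<and>
        xhat k = (1 / weight_sum lam k) *\<^sub>R (\<Sum>i=0..k. lam i *\<^sub>R x (i + 1)))"

definition fast_gradient_method ::
    "'a::real_normed_vector set \<Rightarrow> ('a \<Rightarrow> 'a \<Rightarrow> ereal) \<Rightarrow> ('a \<Rightarrow> ereal) \<Rightarrow> ('a \<Rightarrow> ('a \<Rightarrow>\<^sub>L real)) \<Rightarrow> 'a \<Rightarrow>
     (int \<Rightarrow> real) \<Rightarrow> (int \<Rightarrow> real) \<Rightarrow> (int \<Rightarrow> 'a \<Rightarrow> ereal) \<Rightarrow>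
     (int \<Rightarrow> 'a) \<Rightarrow> (int \<Rightarrow> 'a) \<Rightarrow> (int \<Rightarrow> 'a) \<Rightarrow> bool" where
  "fast_gradient_method Q lf d Dd x0 lam \<beta> \<psi> z x xhat \<longleftrightarrow>
     auxiliary_functions Q lf d Dd x0 lam \<beta> x z \<psi> \<and>
     x 0 = x0 \<and> z (-1) = x0 \<and>
     is_arg_min (\<psi> 0) (\<lambda>u. u \<in> Q) (z 0) \<and> xhat 0 = z 0 \<and>
     (\<forall>k\<ge>0.
        x (k + 1) = (1 / weight_sum lam (k + 1)) *\<^sub>R ((\<Sum>i=0..k. lam i *\<^sub>R z i) + lam (k + 1) *\<^sub>R z k) \<and>
        is_arg_min (\<psi> (k + 1)) (\<lambda>u. u \<in> Q) (z (k + 1)) \<and>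
        xhat (k + 1) = (1 / weight_sum lam (k + 1)) *\<^sub>R (\<Sum>i=0..k + 1. lam i *\<^sub>R z i))"

end

theory Submission
  imports Defs
begin

text \<open>On \<open>Q\<close> the functions \<open>f\<close>, \<open>d\<close> and the lower models are finite, so the argument takes place over the reals.

  The minimum \<open>m k\<close> of \<open>\<psi> k\<close> over \<open>Q\<close> is an intermediate quantity between the achieved values of \<open>f\<close>
  and the optimal one.  From above, it is at most the weighted sum of the lower models at any point
  \<open>w\<close> of \<open>Q\<close>, plus \<open>\<beta> k * l_d (z k; w)\<close>; as the models minorize \<open>f\<close>, this is at most
  \<open>S k * f w + \<beta> k * l_d (z k; w)\<close>.  From below, one step raises it by at least the weighted new model value at
  the new minimizer plus \<open>\<beta> k\<close> times a Bregman distance, and strong convexity turns the latter into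
  \<open>\<beta> k * \<sigma> / 2\<close> times the squared displacement of the minimizer.  The parameter conditions
  ensure that this quadratic pays for the one in the upper model of \<open>f\<close>, so that \<open>m k\<close> dominates the weighted function
  values of the iterates up to the errors \<open>\<delta>\<close>.  In the fast method the step taken by the averaged
  iterate is the displacement of the minimizer scaled by \<open>lam / S\<close>, and convexity of the model lets the
  value of the previous average be carried along; this is why the weaker condition there
  suffices and why the errors accumulate with weights \<open>S i\<close>.

  Under Property 1 both estimates on \<open>m k\<close> come directly from its inequalities
  (\<open>certificate_of_property1\<close>).  For the standard
  construction (\<open>certificate_of_standard_construction\<close>) they rest on one observation: if \<open>p\<close> minimizes \<open>\<phi> + \<beta> d\<close> over \<open>Q\<close> with \<open>\<phi>\<close>
  convex, then \<open>d\<close> may be linearized at \<open>p\<close> (\<open>minimizer_linearized\<close>).  The two methods then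
  differ only in the weight \<open>s\<close> given to the previous iterate in \<open>averaging_step\<close>.\<close>

section \<open>Extended-valued functions that are finite on a convex set\<close>

lemma proper_real_on:
  assumes "proper_lsc_convex g" "g w < \<infinity>"
  shows "g w = ereal (real_of_ereal (g w))"
  using assms by (cases "g w") (auto simp: proper_lsc_convex_def proper_fun_def)

lemma proper_convex_on_real:
  assumes g: "proper_lsc_convex g" and S: "convex S" and fin: "\<And>w. w \<in> S \<Longrightarrow> g w < \<infinity>"
  shows "convex_on S (\<lambda>w. real_of_ereal (g w))"
proof (rule convex_onI[OF _ S])
  fix t :: real and u v assume t: "0 < t" "t < 1" and uv: "u \<in> S" "v \<in> S"
  let ?w = "(1 - t) *\<^sub>R u + t *\<^sub>R v"
  have w: "?w \<in> S" using S t uv by (auto simp: convex_def)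
  have "\<forall>u v. \<forall>s\<in>{0..1}. g (s *\<^sub>R u + (1 - s) *\<^sub>R v) \<le> ereal s * g u + ereal (1 - s) * g v"
    using g by (simp add: proper_lsc_convex_def convex_fun_def)
  from this[rule_format, of "1 - t" u v] t
  have "g ?w \<le> ereal (1 - t) * g u + ereal t * g v" by simp
  then have "ereal (real_of_ereal (g ?w))
      \<le> ereal (1 - t) * ereal (real_of_ereal (g u)) + ereal t * ereal (real_of_ereal (g v))"
    using proper_real_on[OF g fin[OF w]] proper_real_on[OF g fin[OF uv(1)]]
      proper_real_on[OF g fin[OF uv(2)]] by metis
  then show "real_of_ereal (g ?w) \<le> (1 - t) * real_of_ereal (g u) + t * real_of_ereal (g v)" by simp
qed

lemma INF_arg_min:
  fixes g :: "'a \<Rightarrow> 'b::complete_linorder"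
  assumes "is_arg_min g (\<lambda>w. w \<in> S) p"
  shows "(INF w\<in>S. g w) = g p"
  using assms by (intro antisym INF_lower INF_greatest) (auto simp: is_arg_min_def not_less)

section \<open>First-order inequalities along segments\<close>

text \<open>Both first-order facts used below, the minimality condition and the Bregman lower bound, compare
  \<open>D\<close> with a quadratic in the parameter of a segment issuing from \<open>p\<close>.  Dividing by the parameter
  and letting it tend to zero turns the comparison into one for the derivative; working on
  segments is what makes a derivative within \<open>S\<close> sufficient, even where \<open>S\<close> has no interior.\<close>

lemma derivative_le_of_segment_bound:
  fixes D :: "'a::real_normed_vector \<Rightarrow> real"
  assumes der: "(D has_derivative D') (at p within S)"
    and S: "convex S" and pw: "p \<in> S" "w \<in> S"
    and bound: "\<And>t. 0 < t \<Longrightarrow> t < 1 \<Longrightarrow> D (p + t *\<^sub>R (w - p)) - D p \<le> t * (a + t * b)"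
  shows "D' (w - p) \<le> a"
proof -
  let ?\<gamma> = "\<lambda>t::real. p + t *\<^sub>R (w - p)"
  have "?\<gamma> ` {0..1} \<subseteq> S"
  proof
    fix v assume "v \<in> ?\<gamma> ` {0..1}"
    then obtain t where t: "0 \<le> t" "t \<le> 1" and v: "v = (1 - t) *\<^sub>R p + t *\<^sub>R w"
      by (auto simp: algebra_simps)
    show "v \<in> S" unfolding v using S pw t by (auto simp: convex_def)
  qed
  then have "(D has_derivative D') (at (?\<gamma> 0) within ?\<gamma> ` {0..1})"
    using der by (auto intro: has_derivative_subset)
  moreover have "(?\<gamma> has_derivative (\<lambda>t. t *\<^sub>R (w - p))) (at 0 within {0..1})"
    by (auto intro!: derivative_eq_intros)
  ultimately have "((\<lambda>t. D (?\<gamma> t)) has_derivative (\<lambda>t. D' (t *\<^sub>R (w - p)))) (at 0 within {0..1})"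
    using has_derivative_in_compose by blast
  moreover have "D' (t *\<^sub>R (w - p)) = D' (w - p) * t" for t :: real
    using has_derivative_bounded_linear[OF der] by (simp add: linear_simps mult.commute)
  ultimately have "((\<lambda>t. D (?\<gamma> t)) has_field_derivative D' (w - p)) (at 0 within {0..1})"
    by (simp add: has_field_derivative_def)
  then have "((\<lambda>t. (D (?\<gamma> t) - D p) / t) \<longlongrightarrow> D' (w - p)) (at 0 within {0..1})"
    by (simp add: has_field_derivative_iff)
  then have quot: "((\<lambda>t. (D (?\<gamma> t) - D p) / t) \<longlongrightarrow> D' (w - p)) (at_right 0)"
    by (simp add: at_within_Icc_at_right)
  have lim: "((\<lambda>t. a + t * b) \<longlongrightarrow> a) (at_right 0)"
    by (auto intro!: tendsto_eq_intros)
  have "eventually (\<lambda>t. (D (?\<gamma> t) - D p) / t \<le> a + t * b) (at_right 0)"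
    unfolding eventually_at_right_field
    using bound by (intro exI[of _ 1]) (auto simp: divide_le_eq mult.commute)
  then show ?thesis
    by (intro tendsto_le[OF _ lim quot]) auto
qed

text \<open>At a minimizer of \<open>g + b D\<close> with \<open>g\<close> convex, the smooth part may be replaced by its
  linearization: moving a fraction \<open>t\<close> of the way to \<open>w\<close> raises \<open>g\<close> by at most
  \<open>t (g w - g p)\<close>, so \<open>b D\<close> cannot fall faster than that.  This stands in for the
  optimality condition in terms of subgradients of \<open>g\<close>.\<close>

lemma minimizer_linearized:
  fixes D g :: "'a::real_normed_vector \<Rightarrow> real"
  assumes der: "(D has_derivative D') (at p within S)"
    and g: "convex_on S g" and pw: "p \<in> S" "w \<in> S"
    and min: "\<And>u. u \<in> S \<Longrightarrow> g p + b * D p \<le> g u + b * D u"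
  shows "g p + b * D p \<le> g w + b * (D p + D' (w - p))"
proof -
  have S: "convex S" using g by (simp add: convex_on_def)
  have "((\<lambda>u. (- b) * D u) has_derivative (\<lambda>h. (- b) * D' h)) (at p within S)"
    using der by (rule has_derivative_mult_right)
  then have "(- b) * D' (w - p) \<le> g w - g p"
  proof (rule derivative_le_of_segment_bound[OF _ S pw, where b = 0])
    fix t :: real assume t: "0 < t" "t < 1"
    have eq: "p + t *\<^sub>R (w - p) = (1 - t) *\<^sub>R p + t *\<^sub>R w" by (simp add: algebra_simps)
    have "(1 - t) *\<^sub>R p + t *\<^sub>R w \<in> S" using S pw t by (auto simp: convex_def)
    from min[OF this] convex_onD[OF g, of t p w] t pw
    show "- b * D (p + t *\<^sub>R (w - p)) - - b * D p \<le> t * (g w - g p + t * 0)"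
      unfolding eq by (simp add: algebra_simps)
  qed
  then show ?thesis by (simp add: algebra_simps)
qed

section \<open>The common setting of both methods\<close>

locale gradient_setting =
  fixes Q :: "'a::real_normed_vector set"
    and f d :: "'a \<Rightarrow> ereal"
    and lf :: "'a \<Rightarrow> 'a \<Rightarrow> ereal"
    and Dd :: "'a \<Rightarrow> ('a \<Rightarrow>\<^sub>L real)"
    and L \<delta> :: "'a \<Rightarrow> real"
    and \<sigma> :: real
    and x0 :: 'a
    and lam \<beta> :: "int \<Rightarrow> real"
  assumes convex_Q: "convex Q"
    and f: "proper_lsc_convex f" "Q \<subseteq> effective_domain f"
    and prox: "prox_function Q \<sigma> d Dd x0"
    and params: "method_parameters lam \<beta>"
    and approx: "lower_convex_approximation Q f lf"
    and struct: "\<forall>y\<in>Q. \<forall>w\<in>Q. lf y w \<le> f w \<and>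
                   f w \<le> lf y w + ereal (L y / 2 * (norm (w - y))\<^sup>2 + \<delta> y)"
begin

definition "F w = real_of_ereal (f w)"
definition "D w = real_of_ereal (d w)"
definition "LF y w = real_of_ereal (lf y w)"
abbreviation "S k \<equiv> weight_sum lam k"
abbreviation "lD \<equiv> l_d d Dd"

lemma f_real: "w \<in> Q \<Longrightarrow> f w = ereal (F w)"
  unfolding F_def using f by (intro proper_real_on) (auto simp: effective_domain_def)

lemma lf_less_top: "y \<in> Q \<Longrightarrow> w \<in> Q \<Longrightarrow> lf y w < \<infinity>"
  using struct f(2) unfolding effective_domain_def by (metis (mono_tags) mem_Collect_eq order_le_less_trans subsetD)

lemma lf_proper: "y \<in> Q \<Longrightarrow> proper_lsc_convex (lf y)"
  using approx by (simp add: lower_convex_approximation_def)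

lemma lf_real: "y \<in> Q \<Longrightarrow> w \<in> Q \<Longrightarrow> lf y w = ereal (LF y w)"
  unfolding LF_def by (intro proper_real_on lf_proper lf_less_top)

lemma d_proper: "proper_lsc_convex d"
  using prox by (simp add: prox_function_def)

lemma d_real: "w \<in> Q \<Longrightarrow> d w = ereal (D w)"
  unfolding D_def using prox by (intro proper_real_on d_proper)
    (auto simp: prox_function_def continuously_differentiable_on_set_def effective_domain_def)

lemma convex_F: "convex_on Q F"
  unfolding F_def[abs_def]
  using f by (intro proper_convex_on_real convex_Q) (auto simp: effective_domain_def)

lemma convex_LF: "y \<in> Q \<Longrightarrow> convex_on Q (LF y)"
  unfolding LF_def[abs_def]
  by (intro proper_convex_on_real convex_Q lf_proper lf_less_top)

lemma LF_le_F: "y \<in> Q \<Longrightarrow> w \<in> Q \<Longrightarrow> LF y w \<le> F w"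
  using struct lf_real f_real by (metis ereal_less_eq(3))

lemma F_le_LF:
  assumes "y \<in> Q" "w \<in> Q"
  shows "F w \<le> LF y w + L y / 2 * (norm (w - y))\<^sup>2 + \<delta> y"
proof -
  have "f w \<le> lf y w + ereal (L y / 2 * (norm (w - y))\<^sup>2 + \<delta> y)" using struct assms by blast
  then show ?thesis unfolding f_real[OF assms(2)] lf_real[OF assms] by simp
qed

lemma lD_eq: "lD y w = D y + Dd y (w - y)"
  by (simp add: l_d_def D_def)

lemma x0: "x0 \<in> Q" "d x0 = 0" "is_arg_min d (\<lambda>w. w \<in> Q) x0"
  using prox by (auto simp: prox_function_def is_arg_min_def)

lemma d_nonneg: "w \<in> Q \<Longrightarrow> D w \<ge> 0"
  using x0 d_real[of w] by (auto simp: is_arg_min_def not_less zero_ereal_def)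

lemma D_derivative: "y \<in> Q \<Longrightarrow> (D has_derivative blinfun_apply (Dd y)) (at y within Q)"
  unfolding D_def[abs_def]
  using prox by (simp add: prox_function_def continuously_differentiable_on_set_def)

lemma lam_pos: "k \<ge> 0 \<Longrightarrow> lam k > 0"
  using params by (simp add: method_parameters_def)

lemma beta_pos: "k \<ge> -1 \<Longrightarrow> \<beta> k > 0"
  using params[unfolded method_parameters_def, rule_format, of "k + 1"] by simp

lemma beta_mono: "k \<ge> -1 \<Longrightarrow> \<beta> k \<le> \<beta> (k + 1)"
  using params[unfolded method_parameters_def, rule_format, of "k + 1"] by simp

lemma sum_step: "k \<ge> -1 \<Longrightarrow> (\<Sum>i=0..k+1. g i) = (\<Sum>i=0..k. g i) + g (k + 1)"
  for g :: "int \<Rightarrow> 'b::comm_monoid_add"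
  using atLeastAtMostPlus1_int_conv[of 0 k] by (simp add: add.commute)

lemma S_init: "S (-1) = 0"
  by (simp add: weight_sum_def)

lemma S_step: "k \<ge> -1 \<Longrightarrow> S (k + 1) = S k + lam (k + 1)"
  by (simp add: weight_sum_def sum_step)

lemma S_nonneg: "S k \<ge> 0"
  unfolding weight_sum_def by (intro sum_nonneg) (auto intro: less_imp_le lam_pos)

lemma S_pos: "k \<ge> 0 \<Longrightarrow> S k > 0"
  unfolding weight_sum_def by (intro sum_pos) (auto intro: lam_pos)

text \<open>Strong convexity at parameter \<open>t\<close> of the segment from \<open>p\<close> to \<open>w\<close> leaves a slack of
  \<open>\<sigma> / 2 * t * (1 - t)\<close> times the squared distance; divided by \<open>t\<close>, it tends to the quadratic below.\<close>

lemma bregman_lower_bound: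
  assumes "p \<in> Q" "w \<in> Q"
  shows "lD p w + \<sigma> / 2 * (norm (w - p))\<^sup>2 \<le> D w"
proof -
  have "Dd p (w - p) \<le> D w - D p - \<sigma> / 2 * (norm (w - p))\<^sup>2"
  proof (rule derivative_le_of_segment_bound[OF D_derivative convex_Q assms,
        where b = "\<sigma> / 2 * (norm (w - p))\<^sup>2"])
    fix t :: real assume t: "0 < t" "t < 1"
    have eq: "p + t *\<^sub>R (w - p) = t *\<^sub>R w + (1 - t) *\<^sub>R p" by (simp add: algebra_simps)
    have mem: "t *\<^sub>R w + (1 - t) *\<^sub>R p \<in> Q" using convex_Q assms t by (auto simp: convex_def)
    have "d (t *\<^sub>R w + (1 - t) *\<^sub>R p)
        \<le> ereal t * d w + ereal (1 - t) * d p - ereal (1 / 2 * \<sigma> * t * (1 - t) * (norm (w - p))\<^sup>2)"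
      using prox assms t by (simp add: prox_function_def strongly_convex_on_set_def)
    then have "D (t *\<^sub>R w + (1 - t) *\<^sub>R p)
        \<le> t * D w + (1 - t) * D p - 1 / 2 * \<sigma> * t * (1 - t) * (norm (w - p))\<^sup>2"
      unfolding d_real[OF mem] d_real[OF assms(1)] d_real[OF assms(2)] by simp
    then show "D (p + t *\<^sub>R (w - p)) - D p
        \<le> t * (D w - D p - \<sigma> / 2 * (norm (w - p))\<^sup>2 + t * (\<sigma> / 2 * (norm (w - p))\<^sup>2))"
      unfolding eq by (simp add: algebra_simps diff_divide_distrib)
  qed fact
  then show ?thesis by (simp add: lD_eq)
qed

text \<open>This is the only way in which the prox-term enters the recursions: between two steps its
  net contribution is at least a quadratic in the displacement of the minimizer.  The scaling
  parameter may grow because \<open>d\<close> is nonnegative on \<open>Q\<close>.\<close>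

lemma prox_term_growth:
  assumes k: "k \<ge> -1" and "p \<in> Q" "w \<in> Q"
  shows "\<beta> k * (\<sigma> / 2 * (norm (w - p))\<^sup>2) \<le> \<beta> (k + 1) * D w - \<beta> k * lD p w"
proof -
  have "\<beta> k * (lD p w + \<sigma> / 2 * (norm (w - p))\<^sup>2) \<le> \<beta> k * D w"
    using bregman_lower_bound[OF assms(2,3)] beta_pos[OF k] by (intro mult_left_mono) auto
  also have "\<dots> \<le> \<beta> (k + 1) * D w"
    using beta_mono[OF k] d_nonneg[OF assms(3)] by (rule mult_right_mono)
  finally show ?thesis by (simp add: algebra_simps)
qed

section \<open>Certificates from auxiliary functions\<close>

text \<open>What the convergence analysis needs from the auxiliary functions: \<open>m k\<close> is the minimum of
  \<open>\<psi> k\<close> over \<open>Q\<close>.  The functions \<open>\<psi> k\<close> themselves no longer appear, so the analysis is the same for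
  every way of building them.\<close>

definition certificate :: "(int \<Rightarrow> 'a) \<Rightarrow> (int \<Rightarrow> 'a) \<Rightarrow> (int \<Rightarrow> real) \<Rightarrow> bool" where
  "certificate x z m \<longleftrightarrow> m (-1) = 0 \<and> (\<forall>k\<ge>-1. z k \<in> Q) \<and>
     (\<forall>k\<ge>-1. m k + lam (k + 1) * LF (x (k + 1)) (z (k + 1))
        + \<beta> k * (\<sigma> / 2 * (norm (z (k + 1) - z k))\<^sup>2) \<le> m (k + 1)) \<and>
     (\<forall>k\<ge>0. \<forall>w\<in>Q. m k \<le> (\<Sum>i=0..k. lam i * LF (x i) w) + \<beta> k * lD (z k) w)"

lemma md_model_real:
  assumes "(INF u\<in>Q. \<psi> k u) = ereal m" "x (k + 1) \<in> Q" "w \<in> Q"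
  shows "md_model Q lf d Dd lam \<beta> x z \<psi> k w
    = ereal (m + lam (k + 1) * LF (x (k + 1)) w + \<beta> (k + 1) * D w - \<beta> k * lD (z k) w)"
  unfolding md_model_def assms(1) lf_real[OF assms(2,3)] d_real[OF assms(3)] by simp

text \<open>Under Property 1 the only point to check is that the minima are finite, which the two
  inequalities provide by induction: the first keeps them above \<open>-\<infinity>\<close>, the second below \<open>\<infinity>\<close>.\<close>

lemma certificate_of_property1:
  assumes P: "property1 Q lf d Dd x0 lam \<beta> x z \<psi>"
  obtains m where "certificate x z m"
proof
  define m where "m k = real_of_ereal (INF u\<in>Q. \<psi> k u)" for k
  have xQ: "x k \<in> Q" if "k \<ge> 0" for k using P that by (simp add: property1_def)
  have am: "is_arg_min (\<psi> k) (\<lambda>u. u \<in> Q) (z k)" if "k \<ge> -1" for k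
    using P that by (simp add: property1_def)
  have zQ: "z k \<in> Q" if "k \<ge> -1" for k using am[OF that] by (simp add: is_arg_min_def)
  have INF: "(INF u\<in>Q. \<psi> k u) = \<psi> k (z k)" if "k \<ge> -1" for k
    using am[OF that] by (rule INF_arg_min)
  have grow: "md_model Q lf d Dd lam \<beta> x z \<psi> k w \<le> \<psi> (k + 1) w" if "k \<ge> -1" "w \<in> Q" for k w
    using P that by (simp add: property1_def)
  have upper: "(INF u\<in>Q. \<psi> k u) \<le> ereal ((\<Sum>i=0..k. lam i * LF (x i) w) + \<beta> k * lD (z k) w)"
    if k: "k \<ge> 0" and w: "w \<in> Q" for k w
  proof -
    have "(INF u\<in>Q. \<psi> k u) \<le>
        (INF w\<in>Q. (\<Sum>i=0..k. ereal (lam i) * lf (x i) w) + ereal (\<beta> k * l_d d Dd (z k) w))"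
      using P k by (simp add: property1_def)
    also have "\<dots> \<le> (\<Sum>i=0..k. ereal (lam i) * lf (x i) w) + ereal (\<beta> k * lD (z k) w)"
      using w by (rule INF_lower)
    also have "(\<Sum>i=0..k. ereal (lam i) * lf (x i) w) = (\<Sum>i=0..k. ereal (lam i * LF (x i) w))"
      using w by (intro sum.cong) (auto simp: lf_real xQ)
    finally show ?thesis by simp
  qed
  have fin: "(INF u\<in>Q. \<psi> k u) = ereal (m k)" if "k \<ge> -1" for k
    using that
  proof (induction k rule: int_ge_induct)
    case base
    have "(INF u\<in>Q. \<psi> (-1) u) = 0" using P by (simp add: property1_def)
    then show ?case by (simp add: m_def)
  next
    case (step k)
    have k: "k + 1 \<ge> -1" "k + 1 \<ge> 0" using step by auto
    have "md_model Q lf d Dd lam \<beta> x z \<psi> k (z (k + 1)) \<le> (INF u\<in>Q. \<psi> (k + 1) u)"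
      using grow[OF step(1) zQ] k INF by simp
    then have "(INF u\<in>Q. \<psi> (k + 1) u) \<noteq> -\<infinity>"
      unfolding md_model_real[where \<psi> = \<psi> and k = k and x = x and z = z, OF step.IH xQ[OF k(2)] zQ[OF k(1)]] by auto
    moreover have "(INF u\<in>Q. \<psi> (k + 1) u) \<noteq> \<infinity>"
      using upper[OF k(2) x0(1)] by auto
    ultimately show ?case unfolding m_def by (cases "INF u\<in>Q. \<psi> (k + 1) u") auto
  qed
  show "certificate x z m"
    unfolding certificate_def
  proof (intro conjI allI ballI impI)
    have "(INF u\<in>Q. \<psi> (-1) u) = 0" using P by (simp add: property1_def)
    then show "m (-1) = 0" by (simp add: m_def)
    show "z k \<in> Q" if "k \<ge> -1" for k by (rule zQ) fact
    show "m k + lam (k + 1) * LF (x (k + 1)) (z (k + 1))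
        + \<beta> k * (\<sigma> / 2 * (norm (z (k + 1) - z k))\<^sup>2) \<le> m (k + 1)" if "k \<ge> -1" for k
    proof -
      have k: "k + 1 \<ge> -1" "k + 1 \<ge> 0" using that by auto
      have "md_model Q lf d Dd lam \<beta> x z \<psi> k (z (k + 1)) \<le> ereal (m (k + 1))"
        using grow[OF that zQ[OF k(1)]] unfolding fin[OF k(1), symmetric] INF[OF k(1)] .
      then show ?thesis
        unfolding md_model_real[where \<psi> = \<psi> and k = k and x = x and z = z, OF fin[OF that] xQ[OF k(2)] zQ[OF k(1)]]
        using prox_term_growth[OF that zQ[OF that] zQ[OF k(1)]] by simp
    qed
    show "m k \<le> (\<Sum>i=0..k. lam i * LF (x i) w) + \<beta> k * lD (z k) w" if "k \<ge> 0" "w \<in> Q" for k w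
      using upper[OF that] fin[of k] that by simp
  qed
qed

text \<open>The invariant of the standard construction.  Separating the prox-term from a convex \<open>\<phi>\<close> is what
  the minimality condition needs, and the bound on \<open>\<phi>\<close> then yields the upper estimate of the minimum.\<close>

definition splitting :: "(int \<Rightarrow> 'a) \<Rightarrow> (int \<Rightarrow> 'a \<Rightarrow> ereal) \<Rightarrow> int \<Rightarrow> ('a \<Rightarrow> real) \<Rightarrow> bool" where
  "splitting x \<psi> k \<phi> \<longleftrightarrow> convex_on Q \<phi> \<and> (\<forall>w\<in>Q. \<psi> k w = ereal (\<phi> w + \<beta> k * D w)) \<and>
     (\<forall>w\<in>Q. \<phi> w \<le> (\<Sum>i=0..k. lam i * LF (x i) w))"

lemma splitting_minimum:
  assumes sp: "splitting x \<psi> k \<phi>" and am: "is_arg_min (\<psi> k) (\<lambda>u. u \<in> Q) p" and w: "w \<in> Q"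
  shows "\<phi> p + \<beta> k * D p \<le> \<phi> w + \<beta> k * lD p w"
proof -
  have p: "p \<in> Q" using am by (simp add: is_arg_min_def)
  have "\<phi> p + \<beta> k * D p \<le> \<phi> u + \<beta> k * D u" if "u \<in> Q" for u
    using am that p sp by (auto simp: is_arg_min_def splitting_def not_less)
  with sp show ?thesis
    unfolding lD_eq splitting_def by (intro minimizer_linearized[OF D_derivative[OF p]] p w) auto
qed

lemma convex_linearized: "convex_on Q (\<lambda>w. c - b * lD p w)"
proof (rule convex_onI[OF _ convex_Q])
  fix t :: real and u v
  have eq: "(1 - t) *\<^sub>R u + t *\<^sub>R v - p = (1 - t) *\<^sub>R (u - p) + t *\<^sub>R (v - p)"
    by (simp add: algebra_simps)
  have "lD p ((1 - t) *\<^sub>R u + t *\<^sub>R v) = (1 - t) * lD p u + t * lD p v"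
    unfolding lD_eq eq blinfun.add_right blinfun.scaleR_right by (simp add: algebra_simps)
  then show "c - b * lD p ((1 - t) *\<^sub>R u + t *\<^sub>R v) \<le> (1 - t) * (c - b * lD p u) + t * (c - b * lD p v)"
    by (simp only:) (simp add: algebra_simps)
qed

text \<open>Before the new model term is added, the Mirror-Descent model replaces \<open>\<phi>\<close> by \<open>min \<psi> - \<beta> l_d\<close>
  and the Dual-Averaging model keeps \<open>\<phi>\<close>.  By the minimality condition for \<open>\<psi> k\<close> the former
  minorizes the latter, so either choice satisfies both the upper bound that is inherited from \<open>\<phi>\<close>
  and the lower bound by the Mirror-Descent expression.\<close>

lemma splitting_step:
  assumes sp: "splitting x \<psi> k \<phi>" and am: "is_arg_min (\<psi> k) (\<lambda>u. u \<in> Q) (z k)"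
    and k: "k \<ge> -1" and xQ: "x (k + 1) \<in> Q"
    and model: "(\<forall>w\<in>Q. \<psi> (k + 1) w = md_model Q lf d Dd lam \<beta> x z \<psi> k w) \<or>
                (\<forall>w\<in>Q. \<psi> (k + 1) w = da_model lf d lam \<beta> x \<psi> k w)"
  obtains \<phi>' where "splitting x \<psi> (k + 1) \<phi>'"
    "\<And>w. w \<in> Q \<Longrightarrow> (\<phi> (z k) + \<beta> k * D (z k)) - \<beta> k * lD (z k) w + lam (k + 1) * LF (x (k + 1)) w \<le> \<phi>' w"
proof -
  let ?m = "\<phi> (z k) + \<beta> k * D (z k)"
  let ?\<Lambda> = "\<lambda>w. lam (k + 1) * LF (x (k + 1)) w"
  have z: "z k \<in> Q" using am by (simp add: is_arg_min_def)
  have \<Lambda>: "convex_on Q ?\<Lambda>"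
    using lam_pos[of "k + 1"] k by (intro convex_on_cmul convex_LF xQ) auto
  have le: "?m - \<beta> k * lD (z k) w \<le> \<phi> w" if "w \<in> Q" for w
    using splitting_minimum[OF sp am that] by simp
  have \<phi>_le: "\<phi> w + ?\<Lambda> w \<le> (\<Sum>i=0..k+1. lam i * LF (x i) w)" if "w \<in> Q" for w
    using sp that sum_step[OF k, of "\<lambda>i. lam i * LF (x i) w"] by (simp add: splitting_def)
  from model show ?thesis
  proof
    assume md: "\<forall>w\<in>Q. \<psi> (k + 1) w = md_model Q lf d Dd lam \<beta> x z \<psi> k w"
    have INF: "(INF u\<in>Q. \<psi> k u) = ereal ?m"
      using INF_arg_min[OF am] sp z by (simp add: splitting_def)
    show ?thesis
    proof (rule that[of "\<lambda>w. (?m - \<beta> k * lD (z k) w) + ?\<Lambda> w"])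
      show "splitting x \<psi> (k + 1) (\<lambda>w. (?m - \<beta> k * lD (z k) w) + ?\<Lambda> w)"
        unfolding splitting_def
      proof (intro conjI ballI)
        show "convex_on Q (\<lambda>w. (?m - \<beta> k * lD (z k) w) + ?\<Lambda> w)"
          by (intro convex_on_add convex_linearized \<Lambda>)
        fix w assume w: "w \<in> Q"
        show "\<psi> (k + 1) w = ereal (?m - \<beta> k * lD (z k) w + ?\<Lambda> w + \<beta> (k + 1) * D w)"
          using md w md_model_real[where \<psi> = \<psi> and k = k and x = x and z = z, OF INF xQ w] by simp
        show "?m - \<beta> k * lD (z k) w + ?\<Lambda> w \<le> (\<Sum>i=0..k+1. lam i * LF (x i) w)"
          using le[OF w] \<phi>_le[OF w] by simp
      qed
    qed simp
  next
    assume da: "\<forall>w\<in>Q. \<psi> (k + 1) w = da_model lf d lam \<beta> x \<psi> k w"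
    show ?thesis
    proof (rule that[of "\<lambda>w. \<phi> w + ?\<Lambda> w"])
      show "splitting x \<psi> (k + 1) (\<lambda>w. \<phi> w + ?\<Lambda> w)"
        unfolding splitting_def
      proof (intro conjI ballI)
        show "convex_on Q (\<lambda>w. \<phi> w + ?\<Lambda> w)"
          using sp by (intro convex_on_add \<Lambda>) (simp add: splitting_def)
        fix w assume w: "w \<in> Q"
        have "\<psi> k w = ereal (\<phi> w + \<beta> k * D w)" using sp w by (simp add: splitting_def)
        then show "\<psi> (k + 1) w = ereal (\<phi> w + ?\<Lambda> w + \<beta> (k + 1) * D w)"
          using da w by (simp add: da_model_def lf_real[OF xQ w] d_real[OF w])
        show "\<phi> w + ?\<Lambda> w \<le> (\<Sum>i=0..k+1. lam i * LF (x i) w)" by (rule \<phi>_le[OF w])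
      qed
    qed (use le in auto)
  qed
qed

lemma certificate_of_standard_construction:
  assumes C: "standard_construction Q lf d Dd lam \<beta> x z \<psi>"
    and am: "\<And>k. k \<ge> -1 \<Longrightarrow> is_arg_min (\<psi> k) (\<lambda>u. u \<in> Q) (z k)"
    and xQ: "\<And>k. k \<ge> 0 \<Longrightarrow> x k \<in> Q"
  obtains m where "certificate x z m"
proof
  define m where "m k = real_of_ereal (\<psi> k (z k))" for k
  have zQ: "z k \<in> Q" if "k \<ge> -1" for k using am[OF that] by (simp add: is_arg_min_def)
  have \<psi>_init: "\<psi> (-1) w = ereal (\<beta> (-1)) * d w" if "w \<in> Q" for w
    using C that by (simp add: standard_construction_def)
  have model: "(\<forall>w\<in>Q. \<psi> (k + 1) w = md_model Q lf d Dd lam \<beta> x z \<psi> k w) \<or>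
              (\<forall>w\<in>Q. \<psi> (k + 1) w = da_model lf d lam \<beta> x \<psi> k w)" if "k \<ge> -1" for k
    using C that by (simp add: standard_construction_def)
  have split: "\<exists>\<phi>. splitting x \<psi> k \<phi>" if "k \<ge> -1" for k
    using that
  proof (induction k rule: int_ge_induct)
    case base
    have "convex_on Q (\<lambda>_. 0)" using convex_Q by (simp add: convex_on_def)
    then have "splitting x \<psi> (-1) (\<lambda>_. 0)"
      by (simp add: splitting_def \<psi>_init d_real)
    then show ?case by blast
  next
    case (step k)
    have "k + 1 \<ge> 0" using step(1) by simp
    from step.IH obtain \<phi> where "splitting x \<psi> k \<phi>" ..
    then obtain \<phi>' where "splitting x \<psi> (k + 1) \<phi>'"
      by (rule splitting_step[OF _ am[OF step(1)] step(1) xQ[OF \<open>k + 1 \<ge> 0\<close>] model[OF step(1)]])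
    then show ?case by blast
  qed
  have m_eq: "m k = \<phi> (z k) + \<beta> k * D (z k)" if "splitting x \<psi> k \<phi>" "k \<ge> -1" for k \<phi>
    using that zQ by (simp add: splitting_def m_def)
  show "certificate x z m"
    unfolding certificate_def
  proof (intro conjI allI ballI impI)
    \<comment> \<open>\<open>z (-1)\<close> minimizes a positive multiple of \<open>d\<close>, whose minimum over \<open>Q\<close> is normalized to \<open>0\<close>.\<close>
    have "is_arg_min d (\<lambda>w. w \<in> Q) (z (-1))"
      using am[of "-1"] beta_pos[of "-1"] by (auto simp: is_arg_min_def \<psi>_init d_real)
    then have "d (z (-1)) = 0"
      using x0 by (auto simp: is_arg_min_def not_less intro!: antisym)
    then show "m (-1) = 0" by (simp add: m_def \<psi>_init[OF zQ])
    show "z k \<in> Q" if "k \<ge> -1" for k by (rule zQ) fact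
    show "m k + lam (k + 1) * LF (x (k + 1)) (z (k + 1))
        + \<beta> k * (\<sigma> / 2 * (norm (z (k + 1) - z k))\<^sup>2) \<le> m (k + 1)" if "k \<ge> -1" for k
    proof -
      have k: "k + 1 \<ge> -1" "k + 1 \<ge> 0" using that by auto
      obtain \<phi> where \<phi>: "splitting x \<psi> k \<phi>" using split[OF \<open>k \<ge> -1\<close>] ..
      obtain \<phi>' where \<phi>': "splitting x \<psi> (k + 1) \<phi>'"
        and le: "\<And>w. w \<in> Q \<Longrightarrow> (\<phi> (z k) + \<beta> k * D (z k)) - \<beta> k * lD (z k) w
            + lam (k + 1) * LF (x (k + 1)) w \<le> \<phi>' w"
        by (rule splitting_step[OF \<phi> am[OF \<open>k \<ge> -1\<close>] \<open>k \<ge> -1\<close> xQ[OF k(2)] model[OF \<open>k \<ge> -1\<close>]], rule that) blast+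
      show ?thesis
        using le[OF zQ[OF k(1)]] prox_term_growth[OF that zQ[OF that] zQ[OF k(1)]]
        unfolding m_eq[OF \<phi> that] m_eq[OF \<phi>' k(1)] by linarith
    qed
    show "m k \<le> (\<Sum>i=0..k. lam i * LF (x i) w) + \<beta> k * lD (z k) w" if "k \<ge> 0" "w \<in> Q" for k w
    proof -
      have k: "k \<ge> -1" using that by simp
      obtain \<phi> where \<phi>: "splitting x \<psi> k \<phi>" using split[OF k] ..
      moreover have "\<phi> w \<le> (\<Sum>i=0..k. lam i * LF (x i) w)"
        using \<phi> that by (simp add: splitting_def)
      ultimately show ?thesis
        using splitting_minimum[OF \<phi> am[OF k] that(2)] m_eq[OF \<phi> k] by linarith
    qed
  qed
qed

section \<open>The recursion for the objective values\<close>

text \<open>One step of either method.  The test point \<open>y\<close> and the new iterate \<open>p'\<close> are the same average of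
  \<open>p\<close> with the old and the new minimizer, so \<open>p' - y\<close> is the displacement \<open>v' - v\<close> shrunk by
  \<open>l / (s + l)\<close>; the factor is squared in the upper model, which is what the
  hypothesis on \<open>L y\<close> exploits.  With \<open>s = 0\<close> this is the step of the classical method.\<close>

lemma averaging_step:
  assumes mem: "p \<in> Q" "v \<in> Q" "v' \<in> Q" and s: "s \<ge> 0" and l: "l > 0"
    and y: "y = (1 / (s + l)) *\<^sub>R (s *\<^sub>R p + l *\<^sub>R v)"
    and p': "p' = (1 / (s + l)) *\<^sub>R (s *\<^sub>R p + l *\<^sub>R v')"
    and L: "L y \<le> \<sigma> * b * (s + l) / l\<^sup>2"
  shows "y \<in> Q" "p' \<in> Q"
    "(s + l) * (F p' - \<delta> y) \<le> s * F p + l * LF y v' + b * (\<sigma> / 2 * (norm (v' - v))\<^sup>2)"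
proof -
  have sl: "s + l > 0" using s l by simp
  have coeff: "s / (s + l) \<ge> 0" "l / (s + l) \<ge> 0" "s / (s + l) + l / (s + l) = 1"
    using s l sl by (auto simp: add_divide_distrib[symmetric])
  have y': "y = (s / (s + l)) *\<^sub>R p + (l / (s + l)) *\<^sub>R v"
    and p'': "p' = (s / (s + l)) *\<^sub>R p + (l / (s + l)) *\<^sub>R v'"
    by (simp_all add: y p' scaleR_add_right)
  show yQ: "y \<in> Q" and pQ: "p' \<in> Q"
    unfolding y' p'' using convexD[OF convex_Q] mem coeff by auto
  have "p' - y = (l / (s + l)) *\<^sub>R (v' - v)" by (simp add: y' p'' scaleR_diff_right)
  then have norm: "(norm (p' - y))\<^sup>2 = l\<^sup>2 / (s + l)\<^sup>2 * (norm (v' - v))\<^sup>2"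
    using l sl by (simp add: power_mult_distrib power_divide)
  have "LF y p' \<le> s / (s + l) * LF y p + l / (s + l) * LF y v'"
    using convex_LF[OF yQ] mem coeff unfolding p'' convex_on_def by blast
  then have "(s + l) * LF y p' \<le> (s + l) * (s / (s + l) * LF y p + l / (s + l) * LF y v')"
    using sl by (intro mult_left_mono) auto
  also have "\<dots> = s * LF y p + l * LF y v'"
    using sl by (simp add: distrib_left)
  also have "\<dots> \<le> s * F p + l * LF y v'"
    using LF_le_F[OF yQ mem(1)] s by (simp add: mult_left_mono)
  finally have model: "(s + l) * LF y p' \<le> s * F p + l * LF y v'" .
  have "L y * (l\<^sup>2 / (s + l)) \<le> \<sigma> * b * (s + l) / l\<^sup>2 * (l\<^sup>2 / (s + l))"
    using L l sl by (intro mult_right_mono) auto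
  then have "L y * (l\<^sup>2 / (s + l)) \<le> \<sigma> * b"
    using l sl by simp
  then have bound: "L y * (l\<^sup>2 / (s + l)) * ((norm (v' - v))\<^sup>2 / 2) \<le> \<sigma> * b * ((norm (v' - v))\<^sup>2 / 2)"
    by (rule mult_right_mono) simp
  have "(s + l) * (L y / 2 * (norm (p' - y))\<^sup>2)
      = L y * (l\<^sup>2 / (s + l)) * ((norm (v' - v))\<^sup>2 / 2)"
    unfolding norm using sl by (simp add: power2_eq_square ac_simps)
  also note bound
  also have "\<sigma> * b * ((norm (v' - v))\<^sup>2 / 2) = b * (\<sigma> / 2 * (norm (v' - v))\<^sup>2)"
    by simp
  finally have quad: "(s + l) * (L y / 2 * (norm (p' - y))\<^sup>2) \<le> b * (\<sigma> / 2 * (norm (v' - v))\<^sup>2)" .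
  have "(s + l) * (F p' - \<delta> y) \<le> (s + l) * (LF y p' + L y / 2 * (norm (p' - y))\<^sup>2)"
    using F_le_LF[OF yQ pQ] sl by (intro mult_left_mono) auto
  also have "\<dots> = (s + l) * LF y p' + (s + l) * (L y / 2 * (norm (p' - y))\<^sup>2)"
    by (rule distrib_left)
  finally show "(s + l) * (F p' - \<delta> y) \<le> s * F p + l * LF y v' + b * (\<sigma> / 2 * (norm (v' - v))\<^sup>2)"
    using model quad by linarith
qed

lemma certificate_le:
  assumes cert: "certificate x z m" and xQ: "\<And>k. k \<ge> 0 \<Longrightarrow> x k \<in> Q" and k: "k \<ge> 0" and w: "w \<in> Q"
  shows "m k \<le> S k * F w + \<beta> k * lD (z k) w"
proof -
  have "m k \<le> (\<Sum>i=0..k. lam i * LF (x i) w) + \<beta> k * lD (z k) w"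
    using cert k w by (simp add: certificate_def)
  moreover have "(\<Sum>i=0..k. lam i * LF (x i) w) \<le> (\<Sum>i=0..k. lam i * F w)"
    using w by (intro sum_mono mult_left_mono LF_le_F xQ less_imp_le[OF lam_pos]) auto
  ultimately show ?thesis by (simp add: weight_sum_def sum_distrib_right)
qed

lemma classical_values_le:
  assumes cert: "certificate x z m" and x: "\<And>k. k \<ge> 0 \<Longrightarrow> x k = z (k - 1)"
    and L: "\<And>k. k \<ge> 0 \<Longrightarrow> \<sigma> * \<beta> (k - 1) / lam k \<ge> L (x k)" and k: "k \<ge> -1"
  shows "(\<Sum>i=0..k. lam i * F (x (i + 1))) - (\<Sum>i=0..k. lam i * \<delta> (x i)) \<le> m k"
  using k
proof (induction k rule: int_ge_induct)
  case base
  then show ?case using cert by (simp add: certificate_def)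
next
  case (step k)
  have k1: "k + 1 \<ge> 0" using step(1) by simp
  have z: "z k \<in> Q" "z (k + 1) \<in> Q" using cert step(1) by (auto simp: certificate_def)
  have x': "x (k + 1) = z k" "x (k + 1 + 1) = z (k + 1)"
    using x[of "k + 1"] x[of "k + 1 + 1"] k1 by (simp_all only: add_diff_cancel_right')
  have "L (z k) \<le> \<sigma> * \<beta> k * (0 + lam (k + 1)) / (lam (k + 1))\<^sup>2"
    using L[OF k1] lam_pos[OF k1] by (simp add: x' power2_eq_square)
  from averaging_step(3)[OF z(1) z order.refl lam_pos[OF k1] _ _ this, of "z (k + 1)"]
  have "lam (k + 1) * (F (z (k + 1)) - \<delta> (z k))
      \<le> lam (k + 1) * LF (z k) (z (k + 1)) + \<beta> k * (\<sigma> / 2 * (norm (z (k + 1) - z k))\<^sup>2)"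
    using lam_pos[OF k1] by simp
  moreover have "m k + lam (k + 1) * LF (z k) (z (k + 1))
        + \<beta> k * (\<sigma> / 2 * (norm (z (k + 1) - z k))\<^sup>2) \<le> m (k + 1)"
    using cert step(1) unfolding certificate_def by (metis x'(1))
  moreover have "(\<Sum>i=0..k+1. lam i * F (x (i + 1)))
      = (\<Sum>i=0..k. lam i * F (x (i + 1))) + lam (k + 1) * F (z (k + 1))"
    using sum_step[OF step(1), of "\<lambda>i. lam i * F (x (i + 1))"] unfolding x' .
  moreover have "(\<Sum>i=0..k+1. lam i * \<delta> (x i)) = (\<Sum>i=0..k. lam i * \<delta> (x i)) + lam (k + 1) * \<delta> (z k)"
    using sum_step[OF step(1), of "\<lambda>i. lam i * \<delta> (x i)"] unfolding x' .
  ultimately show ?case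
    using step.IH unfolding right_diff_distrib by linarith
qed

text \<open>Starting at index \<open>-1\<close> with weight \<open>S (-1) = 0\<close> allows any \<open>p (-1)\<close> in \<open>Q\<close> and makes the induction
  trivial at its base.\<close>

lemma fast_values_le:
  assumes cert: "certificate x z m" and init: "p (-1) \<in> Q"
    and x: "\<And>k. k \<ge> -1 \<Longrightarrow> x (k + 1) = (1 / S (k + 1)) *\<^sub>R (S k *\<^sub>R p k + lam (k + 1) *\<^sub>R z k)"
    and p: "\<And>k. k \<ge> -1 \<Longrightarrow> p (k + 1) = (1 / S (k + 1)) *\<^sub>R (S k *\<^sub>R p k + lam (k + 1) *\<^sub>R z (k + 1))"
    and L: "\<And>k. k \<ge> 0 \<Longrightarrow> \<sigma> * \<beta> (k - 1) * S k / (lam k)\<^sup>2 \<ge> L (x k)" and k: "k \<ge> -1"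
  shows "p k \<in> Q \<and> S k * F (p k) - (\<Sum>i=0..k. S i * \<delta> (x i)) \<le> m k"
  using k
proof (induction k rule: int_ge_induct)
  case base
  then show ?case using cert init by (simp add: certificate_def S_init)
next
  case (step k)
  have k1: "k + 1 \<ge> 0" using step(1) by simp
  have z: "z k \<in> Q" "z (k + 1) \<in> Q" using cert step(1) by (auto simp: certificate_def)
  note S = S_step[OF step(1)]
  have L': "L (x (k + 1)) \<le> \<sigma> * \<beta> k * (S k + lam (k + 1)) / (lam (k + 1))\<^sup>2"
    using L[OF k1] by (simp add: S)
  note st = averaging_step[OF conjunct1[OF step.IH] z S_nonneg lam_pos[OF k1]
      x[OF step(1), unfolded S] p[OF step(1), unfolded S] L']
  have "m k + lam (k + 1) * LF (x (k + 1)) (z (k + 1))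
        + \<beta> k * (\<sigma> / 2 * (norm (z (k + 1) - z k))\<^sup>2) \<le> m (k + 1)"
    using cert step(1) by (simp add: certificate_def)
  moreover have "S (k + 1) * F (p (k + 1)) - S (k + 1) * \<delta> (x (k + 1))
      = (S k + lam (k + 1)) * (F (p (k + 1)) - \<delta> (x (k + 1)))"
    by (simp add: S right_diff_distrib)
  ultimately show ?case
    using step.IH st(2,3) sum_step[OF step(1), of "\<lambda>i. S i * \<delta> (x i)"] by auto
qed

section \<open>The two methods\<close>

lemma weighted_mean:
  assumes k: "k \<ge> 0" and v: "\<And>i. 0 \<le> i \<Longrightarrow> i \<le> k \<Longrightarrow> v i \<in> Q"
  shows "(1 / S k) *\<^sub>R (\<Sum>i=0..k. lam i *\<^sub>R v i) \<in> Q"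
    "F ((1 / S k) *\<^sub>R (\<Sum>i=0..k. lam i *\<^sub>R v i)) \<le> 1 / S k * (\<Sum>i=0..k. lam i * F (v i))"
proof -
  have eq: "(1 / S k) *\<^sub>R (\<Sum>i=0..k. lam i *\<^sub>R v i) = (\<Sum>i=0..k. (lam i / S k) *\<^sub>R v i)"
    by (simp add: scaleR_sum_right)
  have one: "(\<Sum>i=0..k. lam i / S k) = 1"
    using S_pos[OF k] by (simp add: weight_sum_def sum_divide_distrib[symmetric])
  have nonneg: "lam i / S k \<ge> 0" if "i \<in> {0..k}" for i
    using that lam_pos[of i] S_nonneg[of k] by simp
  show "(1 / S k) *\<^sub>R (\<Sum>i=0..k. lam i *\<^sub>R v i) \<in> Q"
    unfolding eq using one nonneg v by (intro convex_sum convex_Q) auto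
  have "F (\<Sum>i=0..k. (lam i / S k) *\<^sub>R v i) \<le> (\<Sum>i=0..k. lam i / S k * F (v i))"
    using one nonneg v k by (intro convex_on_sum[OF _ _ convex_F]) auto
  then show "F ((1 / S k) *\<^sub>R (\<Sum>i=0..k. lam i *\<^sub>R v i)) \<le> 1 / S k * (\<Sum>i=0..k. lam i * F (v i))"
    unfolding eq by (simp add: sum_distrib_left)
qed

lemma classical_bound:
  assumes M: "classical_gradient_method Q lf d Dd x0 lam \<beta> \<psi> z x xhat"
    and L: "\<And>k. k \<ge> 0 \<Longrightarrow> \<sigma> * \<beta> (k - 1) / lam k \<ge> L (x k)"
    and k: "k \<ge> 0" and w: "w \<in> Q"
  shows "f (xhat k) - f w
           \<le> ereal (1 / S k) * (\<Sum>i=0..k. ereal (lam i) * f (x (i + 1))) - f w"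
    "ereal (1 / S k) * (\<Sum>i=0..k. ereal (lam i) * f (x (i + 1))) - f w
       \<le> ereal ((\<beta> k * lD (z k) w + (\<Sum>i=0..k. lam i * \<delta> (x i))) / S k)"
proof -
  have am: "is_arg_min (\<psi> k) (\<lambda>u. u \<in> Q) (z k)" if "k \<ge> -1" for k
  proof -
    have "k + 1 \<ge> 0" using that by simp
    then have "is_arg_min (\<psi> (k + 1 - 1)) (\<lambda>u. u \<in> Q) (z (k + 1 - 1))"
      using M unfolding classical_gradient_method_def by blast
    then show ?thesis by simp
  qed
  have x: "x k = z (k - 1)" if "k \<ge> 0" for k
    using M that by (simp add: classical_gradient_method_def)
  have xQ: "x k \<in> Q" if "k \<ge> 0" for k
    using am[of "k - 1"] x[OF that] that by (simp add: is_arg_min_def)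
  obtain m where cert: "certificate x z m"
  proof -
    have "standard_construction Q lf d Dd lam \<beta> x z \<psi> \<or> property1 Q lf d Dd x0 lam \<beta> x z \<psi>"
      using M by (simp add: classical_gradient_method_def auxiliary_functions_def)
    then show thesis
    proof
      assume "standard_construction Q lf d Dd lam \<beta> x z \<psi>"
      from certificate_of_standard_construction[OF this am xQ that] show thesis .
    next
      assume "property1 Q lf d Dd x0 lam \<beta> x z \<psi>"
      from certificate_of_property1[OF this that] show thesis .
    qed
  qed
  have xhat: "xhat k = (1 / S k) *\<^sub>R (\<Sum>i=0..k. lam i *\<^sub>R x (i + 1))"
    using M k by (simp add: classical_gradient_method_def)
  have mean: "xhat k \<in> Q" "F (xhat k) \<le> 1 / S k * (\<Sum>i=0..k. lam i * F (x (i + 1)))"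
    unfolding xhat using weighted_mean[OF k, of "\<lambda>i. x (i + 1)"] xQ by auto
  have "(\<Sum>i=0..k. ereal (lam i) * f (x (i + 1))) = (\<Sum>i=0..k. ereal (lam i * F (x (i + 1))))"
    by (intro sum.cong) (auto simp: f_real xQ)
  then have sum: "(\<Sum>i=0..k. ereal (lam i) * f (x (i + 1))) = ereal (\<Sum>i=0..k. lam i * F (x (i + 1)))"
    by simp
  show "f (xhat k) - f w
           \<le> ereal (1 / S k) * (\<Sum>i=0..k. ereal (lam i) * f (x (i + 1))) - f w"
    unfolding sum f_real[OF w] f_real[OF mean(1)] using mean(2) by simp
  have "(\<Sum>i=0..k. lam i * F (x (i + 1))) - S k * F w
      \<le> \<beta> k * lD (z k) w + (\<Sum>i=0..k. lam i * \<delta> (x i))"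
    using classical_values_le[OF cert x L, of k] certificate_le[OF cert xQ k w] k by simp
  then have "1 / S k * (\<Sum>i=0..k. lam i * F (x (i + 1))) - F w
      \<le> (\<beta> k * lD (z k) w + (\<Sum>i=0..k. lam i * \<delta> (x i))) / S k"
    using divide_right_mono[OF _ S_nonneg[of k]] S_pos[OF k] by (fastforce simp: diff_divide_distrib)
  then show "ereal (1 / S k) * (\<Sum>i=0..k. ereal (lam i) * f (x (i + 1))) - f w
       \<le> ereal ((\<beta> k * lD (z k) w + (\<Sum>i=0..k. lam i * \<delta> (x i))) / S k)"
    unfolding sum f_real[OF w] by simp
qed

lemma fast_bound:
  assumes M: "fast_gradient_method Q lf d Dd x0 lam \<beta> \<psi> z x xhat"
    and L: "\<And>k. k \<ge> 0 \<Longrightarrow> \<sigma> * \<beta> (k - 1) * S k / (lam k)\<^sup>2 \<ge> L (x k)"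
    and k: "k \<ge> 0" and w: "w \<in> Q"
  shows "f (xhat k) - f w \<le> ereal ((\<beta> k * lD (z k) w + (\<Sum>i=0..k. S i * \<delta> (x i))) / S k)"
proof -
  have init: "x 0 = x0" "z (-1) = x0" "xhat 0 = z 0"
    using M by (simp_all add: fast_gradient_method_def)
  have am0: "is_arg_min (\<psi> k) (\<lambda>u. u \<in> Q) (z k)" if "k \<ge> 0" for k
  proof (cases "k = 0")
    case True
    then show ?thesis using M by (simp add: fast_gradient_method_def)
  next
    case False
    then have "k - 1 \<ge> 0" using that by simp
    then have "is_arg_min (\<psi> (k - 1 + 1)) (\<lambda>u. u \<in> Q) (z (k - 1 + 1))"
      using M unfolding fast_gradient_method_def by blast
    then show ?thesis by simp
  qed
  have zQ: "z k \<in> Q" if "k \<ge> -1" for k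
    using am0[of k] that init(2) x0(1) by (cases "k = -1") (auto simp: is_arg_min_def)
  \<comment> \<open>Index \<open>-1\<close> has weight \<open>0\<close>; extending \<open>xhat\<close> there makes the initial step an instance of the general one.\<close>
  define p where "p k = (if k < 0 then x0 else xhat k)" for k
  have xhat: "xhat k = (1 / S k) *\<^sub>R (\<Sum>i=0..k. lam i *\<^sub>R z i)" if "k \<ge> 0" for k
  proof (cases "k = 0")
    case True
    then show ?thesis using lam_pos[of 0] init(3) by (simp add: weight_sum_def)
  next
    case False
    then have "k - 1 \<ge> 0" using that by simp
    then have "xhat (k - 1 + 1) = (1 / S (k - 1 + 1)) *\<^sub>R (\<Sum>i=0..k - 1 + 1. lam i *\<^sub>R z i)"
      using M unfolding fast_gradient_method_def by blast
    then show ?thesis by simp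
  qed
  have Sp: "S k *\<^sub>R p k = (\<Sum>i=0..k. lam i *\<^sub>R z i)" if "k \<ge> -1" for k
  proof (cases "k = -1")
    case False
    then have "k \<ge> 0" using that by simp
    then show ?thesis using S_pos[of k] by (simp add: p_def xhat)
  qed (simp add: S_init)
  have p_step: "p (k + 1) = (1 / S (k + 1)) *\<^sub>R (S k *\<^sub>R p k + lam (k + 1) *\<^sub>R z (k + 1))" if "k \<ge> -1" for k
    unfolding Sp[OF that] using that
    by (simp add: p_def xhat sum_step[OF that, of "\<lambda>i. lam i *\<^sub>R z i"])
  have x_step: "x (k + 1) = (1 / S (k + 1)) *\<^sub>R (S k *\<^sub>R p k + lam (k + 1) *\<^sub>R z k)" if "k \<ge> -1" for k
  proof (cases "k = -1")
    case True
    then show ?thesis using init lam_pos[of 0] by (simp add: S_init) (simp add: weight_sum_def)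
  next
    case False
    then have "k \<ge> 0" using that by simp
    then show ?thesis using M unfolding Sp[OF that] fast_gradient_method_def by blast
  qed
  have pQ: "p k \<in> Q" for k
    unfolding p_def using x0(1) weighted_mean(1)[of k z] xhat[of k] zQ by auto
  have xQ: "x k \<in> Q" if "k \<ge> 0" for k
  proof -
    have k': "k - 1 \<ge> -1" using that by simp
    have Sk: "S k = S (k - 1) + lam k" using S_step[OF k'] by simp
    have "x k = (S (k - 1) / S k) *\<^sub>R p (k - 1) + (lam k / S k) *\<^sub>R z (k - 1)"
      using x_step[OF k'] by (simp add: scaleR_add_right)
    moreover have "S (k - 1) / S k + lam k / S k = 1"
      using S_pos[OF that] Sk by (simp add: add_divide_distrib[symmetric])
    ultimately show ?thesis
      using convexD[OF convex_Q pQ zQ[OF k'], of "S (k - 1) / S k" "lam k / S k" "k - 1"]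
        S_nonneg S_pos[OF that] lam_pos[OF that] by simp
  qed
  have init_min: "is_arg_min (\<psi> (-1)) (\<lambda>u. u \<in> Q) x0"
    if C: "standard_construction Q lf d Dd lam \<beta> x z \<psi>"
  proof -
    have "\<psi> (-1) u = ereal (\<beta> (-1)) * d u" if "u \<in> Q" for u
      using C that by (simp add: standard_construction_def)
    then show ?thesis
      using x0 d_nonneg beta_pos[of "-1"] by (auto simp: is_arg_min_def d_real not_less zero_ereal_def)
  qed
  obtain m where cert: "certificate x z m"
  proof -
    have "standard_construction Q lf d Dd lam \<beta> x z \<psi> \<or> property1 Q lf d Dd x0 lam \<beta> x z \<psi>"
      using M by (simp add: fast_gradient_method_def auxiliary_functions_def)
    then show thesis
    proof
      assume C: "standard_construction Q lf d Dd lam \<beta> x z \<psi>"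
      have am: "is_arg_min (\<psi> k) (\<lambda>u. u \<in> Q) (z k)" if "k \<ge> -1" for k
        using am0[of k] init_min[OF C] that init(2) by (cases "k = -1") auto
      from certificate_of_standard_construction[OF C am xQ that] show thesis .
    next
      assume "property1 Q lf d Dd x0 lam \<beta> x z \<psi>"
      from certificate_of_property1[OF this that] show thesis .
    qed
  qed
  have "xhat k = p k" using k by (simp add: p_def)
  moreover have "S k * F (p k) - (\<Sum>i=0..k. S i * \<delta> (x i)) \<le> m k"
    using fast_values_le[OF cert pQ x_step p_step L, of k] k by simp
  ultimately have "S k * F (xhat k) - S k * F w \<le> \<beta> k * lD (z k) w + (\<Sum>i=0..k. S i * \<delta> (x i))"
    using certificate_le[OF cert xQ k w] by simp
  then have "F (xhat k) - F w \<le> (\<beta> k * lD (z k) w + (\<Sum>i=0..k. S i * \<delta> (x i))) / S k"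
    using S_pos[OF k] by (simp add: field_simps)
  then show ?thesis
    using f_real[OF w] f_real[OF pQ[of k]] \<open>xhat k = p k\<close> by simp
qed

end

theorem corollary5p2:
  fixes Q B :: "'a::real_normed_vector set"
    and f d :: "'a \<Rightarrow> ereal"
    and lf :: "'a \<Rightarrow> 'a \<Rightarrow> ereal"
    and Dd :: "'a \<Rightarrow> ('a \<Rightarrow>\<^sub>L real)"
    and L \<delta> :: "'a \<Rightarrow> real"
    and \<sigma> :: real
    and x0 xstar :: 'a
    and lam \<beta> :: "int \<Rightarrow> real"
    and x z xhat :: "int \<Rightarrow> 'a"
    and \<psi> :: "int \<Rightarrow> 'a \<Rightarrow> ereal"
  assumes fin_dim: "finite_dimensional_vector_space (scaleR :: real \<Rightarrow> 'a \<Rightarrow> 'a) B"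
    and Q: "Q \<noteq> {}" "closed Q" "convex Q"
    and f: "proper_lsc_convex f" "Q \<subseteq> effective_domain f"
    and xstar: "is_arg_min f (\<lambda>w. w \<in> Q) xstar"
    and prox: "prox_function Q \<sigma> d Dd x0"
    and params: "method_parameters lam \<beta>"
    and approx: "lower_convex_approximation Q f lf"
    and L_pos: "\<forall>y\<in>Q. L y > 0"
    and \<delta>_nonneg: "\<forall>y\<in>Q. \<delta> y \<ge> 0"
    and struct: "\<forall>y\<in>Q. \<forall>w\<in>Q. lf y w \<le> f w \<and>
                   f w \<le> lf y w + ereal (L y / 2 * (norm (w - y))\<^sup>2 + \<delta> y)"
  shows "(classical_gradient_method Q lf d Dd x0 lam \<beta> \<psi> z x xhat \<longrightarrow>
          (\<forall>k\<ge>0. \<sigma> * \<beta> (k - 1) / lam k \<ge> L (x k)) \<longrightarrow>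
          (\<forall>k\<ge>0.
             f (xhat k) - f xstar
               \<le> ereal (1 / weight_sum lam k) * (\<Sum>i=0..k. ereal (lam i) * f (x (i + 1))) - f xstar \<and>
             ereal (1 / weight_sum lam k) * (\<Sum>i=0..k. ereal (lam i) * f (x (i + 1))) - f xstar
               \<le> ereal ((\<beta> k * l_d d Dd (z k) xstar + (\<Sum>i=0..k. lam i * \<delta> (x i)))
                         / weight_sum lam k))) \<and>
         (fast_gradient_method Q lf d Dd x0 lam \<beta> \<psi> z x xhat \<longrightarrow>
          (\<forall>k\<ge>0. \<sigma> * \<beta> (k - 1) * weight_sum lam k / (lam k)\<^sup>2 \<ge> L (x k)) \<longrightarrow>
          (\<forall>k\<ge>0.
             f (xhat k) - f xstar
               \<le> ereal ((\<beta> k * l_d d Dd (z k) xstar + (\<Sum>i=0..k. weight_sum lam i * \<delta> (x i)))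
                         / weight_sum lam k)))"
proof -
  interpret gradient_setting Q f d lf Dd L \<delta> \<sigma> x0 lam \<beta>
    using Q(3) f prox params approx struct by (rule gradient_setting.intro)
  have "xstar \<in> Q" using xstar by (simp add: is_arg_min_def)
  then show ?thesis
    using classical_bound[of \<psi> z x xhat _ xstar] fast_bound[of \<psi> z x xhat _ xstar] by auto
qed

end
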